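(* Let $m\in\mathbb{N}\setminus\{0,1\}$. Then $\mathscr{L}_{2,m}=\mathscr{C}(m,\{1,\ldots,m-1\}^3)$.
   Context: $\mathbb{N}$ is the set of non-negative integers. A numerical semigroup is a subset $S\subseteq\mathbb{N}$ closed under addition, with $0\in S$ and $\mathbb{N}\setminus S$ finite. The multiplicity $\mathrm{m}(S)$ is the least positive element of $S$. $\mathscr{S}_m$ is the set of numerical semigroups with multiplicity $m$. $x \bmod m$ denotes the remainder after division of $x$ by $m$. For an integer $m\ge 2$ and a finite set $A\subseteq\bigcup_{k\geq 2}\{1,\ldots,m-1\}^k$, $\mathscr{C}(m,A)$ is the set of all $S\in\mathscr{S}_m$ such that for every $k\ge 2$ and every $(s_1,\ldots,s_k)\in S^k$ with $(s_1\bmod m,\ldots,s_k\bmod m)\in A$ one has $s_1+\cdots+s_k-m\in S$. A numerical semigroup $S$ is of second-level if $x+y+z-\mathrm{m}(S)\in S$ for all $(x,y,z)\in(S\setminus\{0\})^3$. $\mathscr{L}_{2,m}$ is the set of all second-level numerical semigroups with multiplicity $m$. *)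

theory Defs
  imports Main
begin

definition numerical_semigroup :: "nat set \<Rightarrow> bool" where
  "numerical_semigroup S \<longleftrightarrow>
     0 \<in> S \<and> (\<forall>x\<in>S. \<forall>y\<in>S. x + y \<in> S) \<and> finite (UNIV - S)"

definition mult_of :: "nat set \<Rightarrow> nat" where
  "mult_of S = (LEAST x. x \<in> S \<and> x > 0)"

definition semigroups_of_mult :: "nat \<Rightarrow> nat set set" where
  "semigroups_of_mult m = {S. numerical_semigroup S \<and> mult_of S = m}"

text \<open>A \<open>k\<close>-tuple is a list of length \<open>k\<close>; this is \<open>{1, \<dots>, m - 1}\<^sup>k\<close>.\<close>

definition residue_tuples :: "nat \<Rightarrow> nat \<Rightarrow> nat list set" where
  "residue_tuples m k = {xs. set xs \<subseteq> {1..m - 1} \<and> length xs = k}"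

text \<open>
  The class \<open>C(m, A)\<close>. It is meant for \<open>m \<ge> 2\<close> and those \<open>A\<close> that satisfy
  \<open>pattern_set m A\<close>. Differences are taken in the integers, so that they are
  not truncated at \<open>0\<close>.
\<close>

definition pattern_set :: "nat \<Rightarrow> nat list set \<Rightarrow> bool" where
  "pattern_set m A \<longleftrightarrow> finite A \<and> A \<subseteq> (\<Union>k\<in>{2..}. residue_tuples m k)"

definition pattern_class :: "nat \<Rightarrow> nat list set \<Rightarrow> nat set set" where
  "pattern_class m A =
     {S \<in> semigroups_of_mult m.
        \<forall>k\<ge>2. \<forall>s. length s = k \<and> set s \<subseteq> S \<and> map (\<lambda>x. x mod m) s \<in> A \<longrightarrow>
          int (sum_list s) - int m \<in> int ` S}"

lemma pattern_set_residue_tuples: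
  assumes "k \<ge> 2"
  shows "pattern_set m (residue_tuples m k)"
  using assms finite_lists_length_eq[of "{1..m - 1}" k]
  by (auto simp: pattern_set_def residue_tuples_def)

definition second_level :: "nat set \<Rightarrow> bool" where
  "second_level S \<longleftrightarrow> numerical_semigroup S \<and>
     (\<forall>x\<in>S - {0}. \<forall>y\<in>S - {0}. \<forall>z\<in>S - {0}.
        int x + int y + int z - int (mult_of S) \<in> int ` S)"

definition second_level_of_mult :: "nat \<Rightarrow> nat set set" where
  "second_level_of_mult m = {S \<in> semigroups_of_mult m. second_level S}"

end

theory Submission
  imports Defs
begin

text \<open>
  Elements of \<open>S\<close> with nonzero residue modulo \<open>m\<close> are nonzero, so one inclusion is immediate. For
  the other, the pattern condition handles triples with three nonzero residues; if one of the three
  nonzero elements is divisible by \<open>m\<close>, subtracting \<open>m\<close> from it leaves a multiple of \<open>m\<close>, which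
  lies in \<open>S\<close>.
\<close>

text \<open>A cofinite subset of the naturals is infinite, so it has a positive element and the
  \<open>LEAST\<close> in \<open>mult_of\<close> is attained.\<close>

lemma mult_of_mem:
  assumes "numerical_semigroup S"
  shows "mult_of S \<in> S"
proof -
  have "infinite S"
    using assms Finite_Set.finite_Diff2[of S UNIV] by (auto simp: numerical_semigroup_def)
  then have "\<exists>x. x \<in> S \<and> x > 0"
    by (metis finite.emptyI finite_insert finite_subset insertCI neq0_conv subsetI)
  then show ?thesis
    unfolding mult_of_def using LeastI_ex[of "\<lambda>x. x \<in> S \<and> x > 0"] by blast
qed

lemma numerical_semigroup_add:
  "numerical_semigroup S \<Longrightarrow> x \<in> S \<Longrightarrow> y \<in> S \<Longrightarrow> x + y \<in> S"
  by (simp add: numerical_semigroup_def)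

lemma numerical_semigroup_mult:
  assumes "numerical_semigroup S" and "x \<in> S"
  shows "x * n \<in> S"
  using assms by (induction n) (auto simp: numerical_semigroup_def)

lemma diff_mult_of_mem:
  assumes "numerical_semigroup S" and "x > 0" and "mult_of S dvd x"
    and "y \<in> S" and "z \<in> S"
  shows "int x + int y + int z - int (mult_of S) \<in> int ` S"
proof -
  \<comment> \<open>Since \<open>x\<close> is positive, its quotient by \<open>mult_of S\<close> is
    a successor. Splitting off one copy of \<open>mult_of S\<close> turns the integer difference
    into a sum of naturals.\<close>
  from assms(2,3) obtain n where n: "x = mult_of S + mult_of S * n"
    by (metis dvdE gr0_conv_Suc mult_Suc_right mult_is_0 neq0_conv)
  have "mult_of S * n + y + z \<in> S"
    using assms by (intro numerical_semigroup_add numerical_semigroup_mult mult_of_mem)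
  moreover have "int x + int y + int z - int (mult_of S) = int (mult_of S * n + y + z)"
    using n by simp
  ultimately show ?thesis by (metis imageI)
qed

lemma mod_mem_residues: "(x::nat) mod m \<in> {1..m - 1}" if "m \<ge> 2" "\<not> m dvd x"
  using that mod_less_divisor[of m x]
  by (simp add: mod_greater_zero_iff_not_dvd Suc_le_eq less_eq_Suc_le[symmetric] flip: less_Suc_eq_le)

lemma second_level_imp_pattern:
  assumes "second_level S" and "set s \<subseteq> S"
    and "map (\<lambda>x. x mod mult_of S) s \<in> residue_tuples (mult_of S) 3"
  shows "int (sum_list s) - int (mult_of S) \<in> int ` S"
proof -
  \<comment> \<open>\<open>map\<close> preserves length, so the residue pattern forces
    \<open>s\<close> to be a triple.\<close>
  from assms(3) obtain x y z where s: "s = [x, y, z]"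
    by (auto simp: residue_tuples_def numeral_3_eq_3 length_Suc_conv)
  have "x \<noteq> 0" "y \<noteq> 0" "z \<noteq> 0"
    using assms(3) by (auto simp: s residue_tuples_def intro!: Nat.gr0I)
  then have "int x + int y + int z - int (mult_of S) \<in> int ` S"
    using assms(1,2) by (auto simp: s second_level_def)
  then show ?thesis by (simp add: s add.assoc)
qed

lemma pattern_class_imp_second_level:
  assumes "m \<ge> 2" and S: "S \<in> pattern_class m (residue_tuples m 3)"
  shows "second_level S"
proof -
  have ns: "numerical_semigroup S" and m: "mult_of S = m"
    using S by (auto simp: pattern_class_def semigroups_of_mult_def)
  note dvd = diff_mult_of_mem[OF ns, unfolded m]
  have "int x + int y + int z - int m \<in> int ` S"
    if mem: "x \<in> S" "y \<in> S" "z \<in> S" and pos: "x > 0" "y > 0" "z > 0" for x y z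
  proof -
    consider "m dvd x" | "m dvd y" | "m dvd z" | "\<not> m dvd x" "\<not> m dvd y" "\<not> m dvd z"
      by blast
    then show ?thesis
    proof cases
      case 1
      then show ?thesis using dvd[of x y z] mem pos by simp
    next
      case 2
      \<comment> \<open>By symmetry of the sum, the multiple of \<open>m\<close> can be moved to the
        first place.\<close>
      then show ?thesis using dvd[of y x z] mem pos by (simp add: ac_simps)
    next
      case 3
      then show ?thesis using dvd[of z x y] mem pos by (simp add: ac_simps)
    next
      case 4
      then have "map (\<lambda>x. x mod m) [x, y, z] \<in> residue_tuples m 3"
        using mod_mem_residues[OF assms(1)] by (simp add: residue_tuples_def)
      moreover have "length [x, y, z] = 3" "set [x, y, z] \<subseteq> S" "(3::nat) \<ge> 2"
        using mem by auto
      ultimately have "int (sum_list [x, y, z]) - int m \<in> int ` S"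
        using S unfolding pattern_class_def by blast
      then show ?thesis by (simp add: add.assoc)
    qed
  qed
  then show ?thesis using ns m by (simp add: second_level_def)
qed

theorem proposition3p3:
  fixes m :: nat
  assumes "m \<ge> 2"
  shows "second_level_of_mult m = pattern_class m (residue_tuples m 3)"
proof
  show "second_level_of_mult m \<subseteq> pattern_class m (residue_tuples m 3)"
    \<comment> \<open>The class quantifies over every length \<open>k\<close>, but only lists of
      length 3 can have residues in \<open>residue_tuples m 3\<close>.\<close>
    using second_level_imp_pattern
    by (auto simp: second_level_of_mult_def pattern_class_def semigroups_of_mult_def)
  show "pattern_class m (residue_tuples m 3) \<subseteq> second_level_of_mult m"
    using pattern_class_imp_second_level[OF assms]
    by (auto simp: second_level_of_mult_def pattern_class_def)
qed

end
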